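(* Let $(\alpha_k)_{k\in\mathbb{N}}$ be a nonnegative sequence converging to zero, and let $(w_k)_{k\in\mathbb{N}}$ be a nonnegative sequence such that for some $p_1,p_2>0$, $w_k=\mathcal{O}\big(k^{-p_2}\ln^{p_1}(k)\big)$. Suppose that there exist $c>0$ and $q\in(0,2)$ such that $$\alpha_{k+1}^q\le c(\alpha_k-\alpha_{k+1})+w_k\quad\text{for all }k\in\mathbb{N}.$$ Then the following hold. (i) If $q\in(0,1)$, then $\alpha_k=o\big(k^{-p_2}\ln^{p_1}(k)\big)$. (ii) If $q=1$, then $\alpha_k=\mathcal{O}\big(k^{-p_2}\ln^{p_1}(k)\big)$. (iii) If $q\in(1,2)$, $p_1=q$ and $p_2>1$, then $\alpha_k=\mathcal{O}\Big(k^{-\min\{p_2,\frac{q}{q-1}\}+1}\ln(k)\Big)$.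
   Context: $\ln^{p}(k)=(\ln k)^p$; $\mathcal{O}$ and $o$ are as $k\to\infty$. *)

theory Defs
  imports Complex_Main "HOL-Library.Landau_Symbols"
begin

end

theory Submission
  imports Defs "HOL-Real_Asymp.Real_Asymp"
begin

text \<open>
  The recursion is a comparison principle in disguise. Since
  \<open>x \<mapsto> x powr q + c * x\<close> is strictly increasing on nonnegative arguments, a sequence \<open>v\<close> that
  satisfies the reverse inequality \<open>v (k+1) powr q \<ge> c * (v k - v (k+1)) + w k\<close> from some index on
  and lies above \<open>\<alpha>\<close> at that index stays above \<open>\<alpha>\<close> forever. The barriers used here are the
  multiples \<open>v = A * b\<close> of the claimed rate \<open>b\<close>. Such a multiple satisfies the reverse inequality
  as soon as both \<open>w k\<close> and the decrement \<open>b k - b (k+1)\<close> are controlled by \<open>b (k+1) powr q\<close>, and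
  the factor \<open>A\<close> is then taken large enough to dominate \<open>\<alpha>\<close> at the starting index
  (\<open>bigo_by_barrier\<close>).

  For \<open>q = 1\<close> this applies with \<open>b k = k powr -p2 * (ln k) powr p1\<close>, because \<open>b (k+1) / b k\<close> tends
  to \<open>1\<close> (\<open>linear_recursion_bigo\<close>).

  For \<open>q < 1\<close> we have \<open>\<alpha> k \<le> \<alpha> k powr q\<close> eventually, so the linear case gives \<open>\<alpha> = O(b)\<close>. Feeding
  this back into the recursion yields \<open>\<alpha> powr q = O(b)\<close>, and the spare factor in
  \<open>\<alpha> = \<alpha> powr (1 - q) * \<alpha> powr q\<close> tends to zero, which turns the \<open>O\<close> into an \<open>o\<close>.

  For \<open>q > 1\<close> the rate is \<open>b k = k powr -s * ln k\<close> with \<open>s = min p2 (q / (q - 1)) - 1\<close>. Its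
  decrement has order \<open>k powr (-s - 1) * ln k\<close>, while \<open>b powr q\<close> equals
  \<open>k powr (-s * q) * (ln k) powr q\<close>. So the decrement is controlled because \<open>s * q \<le> s + 1\<close>, that
  is \<open>s \<le> 1 / (q - 1)\<close>, and \<open>w\<close> is controlled because
  \<open>s * q = s + s * (q - 1) \<le> (p2 - 1) + 1\<close>: the two terms of the minimum are exactly what makes
  both estimates work.
\<close>

text \<open>
  The index from which the estimates hold does not depend on the factor \<open>A\<close> of the barrier, so
  \<open>A\<close> can be chosen afterwards, to place the barrier above \<open>a\<close> at that index. The last
  assumption makes all large \<open>A\<close> admissible: it holds for every \<open>D\<close> if \<open>q > 1\<close>, and for \<open>D < 1\<close>
  if \<open>q = 1\<close>.
\<close>

lemma bigo_by_barrier: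
  fixes a w b :: "nat \<Rightarrow> real" and c q C D :: real
  assumes a_nonneg: "\<And>k. 0 \<le> a k" and c: "c > 0" and q: "q > 0"
    and rec: "\<forall>\<^sub>F k in sequentially. a (Suc k) powr q \<le> c * (a k - a (Suc k)) + w k"
    and b_pos: "\<forall>\<^sub>F k in sequentially. 0 < b k"
    and w_le: "\<forall>\<^sub>F k in sequentially. w k \<le> C * b (Suc k) powr q"
    and decr_le: "\<forall>\<^sub>F k in sequentially. c * (b k - b (Suc k)) \<le> D * b (Suc k) powr q"
    and factor: "\<forall>\<^sub>F A in at_top. D * A + C \<le> A powr q"
  shows "a \<in> O(b)"
proof -
  obtain K where K: "\<And>k. k \<ge> K \<Longrightarrow> a (Suc k) powr q \<le> c * (a k - a (Suc k)) + w k"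
    "\<And>k. k \<ge> K \<Longrightarrow> 0 < b k"
    "\<And>k. k \<ge> K \<Longrightarrow> w k \<le> C * b (Suc k) powr q"
    "\<And>k. k \<ge> K \<Longrightarrow> c * (b k - b (Suc k)) \<le> D * b (Suc k) powr q"
    using eventually_conj[OF rec eventually_conj[OF b_pos eventually_conj[OF w_le decr_le]]]
    by (auto simp: eventually_sequentially)
  have "\<forall>\<^sub>F A in at_top. D * A + C \<le> A powr q \<and> A \<ge> max 0 (a K / b K)"
    by (intro eventually_conj factor eventually_ge_at_top)
  then obtain A where A: "D * A + C \<le> A powr q" "A \<ge> 0" "A \<ge> a K / b K"
    by (auto dest!: eventually_happens)
  have le: "a k \<le> A * b k" if "k \<ge> K" for k
    using that
  proof (induction k rule: dec_induct)
    case base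
    show ?case using A(3) K(2)[of K] by (simp add: field_simps)
  next
    case (step k)
    have b: "b (Suc k) > 0" using K(2) step.hyps by simp
    show ?case
    proof (rule ccontr)
      assume "\<not> ?case"
      hence gt: "A * b (Suc k) < a (Suc k)" by simp
      have "A * (c * (b k - b (Suc k))) + w k
            \<le> A * (D * b (Suc k) powr q) + C * b (Suc k) powr q"
        using K(3,4)[OF step.hyps(1)] A(2) by (intro add_mono mult_left_mono) auto
      also have "\<dots> = (D * A + C) * b (Suc k) powr q" by (simp add: algebra_simps)
      also have "\<dots> \<le> A powr q * b (Suc k) powr q"
        using A(1) by (intro mult_right_mono) auto
      also have "\<dots> = (A * b (Suc k)) powr q"
        using A(2) b by (simp add: powr_mult)
      also have "\<dots> < a (Suc k) powr q"
        using gt A(2) b q by (intro powr_less_mono2) auto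
      also have "\<dots> \<le> c * (a k - a (Suc k)) + w k" using K(1) step.hyps by simp
      finally have "c * (A * b k - A * b (Suc k)) < c * (a k - a (Suc k))"
        by (simp add: algebra_simps)
      hence "A * b k - A * b (Suc k) < a k - a (Suc k)" using c by simp
      with gt step.IH show False by simp
    qed
  qed
  show ?thesis
  proof (rule bigoI[of _ A])
    show "\<forall>\<^sub>F k in sequentially. norm (a k) \<le> A * norm (b k)"
      using eventually_ge_at_top[of K]
    proof eventually_elim
      case (elim k)
      thus ?case using le[of k] K(2)[of k] a_nonneg[of k] by simp
    qed
  qed
qed

text \<open>
  The shift to \<open>b (Suc k)\<close> suits the barrier lemma, in which all errors are measured at the new
  index.
\<close>

lemma bigo_eventually_le_shifted:
  fixes f g :: "nat \<Rightarrow> real"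
  assumes "f \<in> O(\<lambda>k. g (Suc k))" and "\<forall>\<^sub>F k in sequentially. 0 \<le> g k"
  obtains C where "\<forall>\<^sub>F k in sequentially. f k \<le> C * g (Suc k)"
proof -
  obtain C where "\<forall>\<^sub>F k in sequentially. norm (f k) \<le> C * norm (g (Suc k))"
    using landau_o.bigE[OF assms(1)] by blast
  moreover have "\<forall>\<^sub>F k in sequentially. 0 \<le> g (Suc k)"
    using assms(2) eventually_sequentially_Suc[of "\<lambda>k. 0 \<le> g k"] by simp
  ultimately have "\<forall>\<^sub>F k in sequentially. f k \<le> C * g (Suc k)"
    by eventually_elim simp
  thus thesis by (rule that)
qed

lemma linear_recursion_bigo:
  fixes a w b :: "nat \<Rightarrow> real" and c :: real
  assumes a_nonneg: "\<And>k. 0 \<le> a k" and c: "c > 0"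
    and rec: "\<forall>\<^sub>F k in sequentially. a (Suc k) \<le> c * (a k - a (Suc k)) + w k"
    and b_pos: "\<forall>\<^sub>F k in sequentially. 0 < b k"
    and b_ratio: "(\<lambda>k. b k / b (Suc k)) \<longlonglongrightarrow> 1"
    and w: "w \<in> O(b)"
  shows "a \<in> O(b)"
proof -
  have b_pos': "\<forall>\<^sub>F k in sequentially. 0 < b (Suc k)"
    using b_pos eventually_sequentially_Suc[of "\<lambda>k. 0 < b k"] by simp
  have b_Suc: "b \<in> O(\<lambda>k. b (Suc k))"
    using b_pos' by (intro bigoI_tendsto[OF b_ratio]) (auto elim: eventually_mono)
  have "\<forall>\<^sub>F k in sequentially. 0 \<le> b k"
    using b_pos by eventually_elim simp
  then obtain C where C: "\<forall>\<^sub>F k in sequentially. w k \<le> C * b (Suc k)"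
    by (rule bigo_eventually_le_shifted[OF landau_o.big_trans[OF w b_Suc]])
  have "\<forall>\<^sub>F k in sequentially. b k / b (Suc k) < 1 + 1 / (2 * c)"
    using c by (intro order_tendstoD(2)[OF b_ratio]) simp
  hence decr: "\<forall>\<^sub>F k in sequentially. c * (b k - b (Suc k)) \<le> 1 / 2 * b (Suc k)"
    using b_pos' by eventually_elim (use c in \<open>simp add: field_simps\<close>)
  show ?thesis
  proof (rule bigo_by_barrier[where w = w and c = c and q = 1 and C = C and D = "1/2"])
    show "\<forall>\<^sub>F k in sequentially. a (Suc k) powr 1 \<le> c * (a k - a (Suc k)) + w k"
      using rec a_nonneg by simp
    show "\<forall>\<^sub>F k in sequentially. w k \<le> C * b (Suc k) powr 1"
      using C b_pos' by eventually_elim simp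
    show "\<forall>\<^sub>F k in sequentially. c * (b k - b (Suc k)) \<le> 1 / 2 * b (Suc k) powr 1"
      using decr b_pos' by eventually_elim simp
    show "\<forall>\<^sub>F A in at_top. 1 / 2 * A + C \<le> A powr 1"
      using eventually_ge_at_top[of "max 0 (2 * C)"] by eventually_elim simp
  qed (use a_nonneg c b_pos in auto)
qed

text \<open>
  One step of the recursion bounds \<open>a (Suc k) powr q\<close> itself by \<open>O(b)\<close>, which is a gain over
  \<open>a (Suc k) = O(b)\<close> because \<open>a (Suc k) powr (1 - q)\<close> vanishes in the limit.
\<close>

lemma sublinear_recursion_smallo:
  fixes a w b :: "nat \<Rightarrow> real" and c q :: real
  assumes a_nonneg: "\<And>k. 0 \<le> a k" and lim: "a \<longlonglongrightarrow> 0" and c: "c > 0"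
    and q: "0 < q" "q < 1"
    and rec: "\<And>k. a (Suc k) powr q \<le> c * (a k - a (Suc k)) + w k"
    and b_pos: "\<forall>\<^sub>F k in sequentially. 0 < b k"
    and b_ratio: "(\<lambda>k. b k / b (Suc k)) \<longlonglongrightarrow> 1"
    and w: "w \<in> O(b)"
  shows "a \<in> o(b)"
proof -
  have lim': "(\<lambda>k. a (Suc k)) \<longlonglongrightarrow> 0" by (rule LIMSEQ_Suc[OF lim])
  have b_Suc: "b \<in> O(\<lambda>k. b (Suc k))"
    using b_pos eventually_sequentially_Suc[of "\<lambda>k. 0 < b k"]
    by (intro bigoI_tendsto[OF b_ratio]) (auto elim: eventually_mono)
  have "\<forall>\<^sub>F k in sequentially. a (Suc k) < 1"
    by (rule order_tendstoD(2)[OF lim']) simp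
  hence "\<forall>\<^sub>F k in sequentially. a (Suc k) \<le> c * (a k - a (Suc k)) + w k"
  proof eventually_elim
    case (elim k)
    have "a (Suc k) powr 1 \<le> a (Suc k) powr q"
      using elim a_nonneg[of "Suc k"] q by (intro powr_mono') auto
    thus ?case using rec[of k] a_nonneg[of "Suc k"] by simp
  qed
  hence a_bigo: "a \<in> O(b)"
    by (rule linear_recursion_bigo[OF a_nonneg c _ b_pos b_ratio w])
  have "(\<lambda>k. a (Suc k) powr q) \<in> O(\<lambda>k. c * a k + w k)"
  proof (intro bigoI[of _ 1] always_eventually allI)
    fix k
    have "0 \<le> c * a (Suc k)" using c a_nonneg by simp
    with rec[of k] have "a (Suc k) powr q \<le> c * a k + w k" by (simp add: algebra_simps)
    thus "norm (a (Suc k) powr q) \<le> 1 * norm (c * a k + w k)" by simp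
  qed
  also have "(\<lambda>k. c * a k + w k) \<in> O(b)"
    using a_bigo w c by (intro sum_in_bigo) simp_all
  also note b_Suc
  finally have power_bigo: "(\<lambda>k. a (Suc k) powr q) \<in> O(\<lambda>k. b (Suc k))" .
  have "(\<lambda>k. a (Suc k) powr (1 - q)) \<longlonglongrightarrow> 0"
    using tendsto_powr2[OF lim' tendsto_const[of "1 - q"]] a_nonneg q by simp
  hence "(\<lambda>k. a (Suc k) powr (1 - q)) \<in> o(\<lambda>_. 1)"
    by (intro smalloI_tendsto) simp_all
  from landau_o.small_big_mult[OF this power_bigo]
  have "(\<lambda>k. a (Suc k) powr (1 - q) * a (Suc k) powr q) \<in> o(\<lambda>k. b (Suc k))" by simp
  moreover have "a (Suc k) powr (1 - q) * a (Suc k) powr q = a (Suc k)" for k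
    using a_nonneg[of "Suc k"] by (simp flip: powr_add)
  ultimately have "(\<lambda>k. a (Suc k)) \<in> o(\<lambda>k. b (Suc k))" by simp
  hence "(\<lambda>k. a (Suc (k - 1))) \<in> o(\<lambda>k. b (Suc (k - 1)))"
    by (rule landau_o.small.compose) real_asymp
  moreover have "\<forall>\<^sub>F k in sequentially. Suc (k - 1) = k"
    using eventually_gt_at_top[of 0] by eventually_elim simp
  ultimately show ?thesis
    by (elim landau_o.small.cong_ex[THEN iffD1, rotated -1]) 
       (auto elim: eventually_mono)
qed

text \<open>
  The two upper bounds on \<open>s\<close> balance \<open>b powr q\<close>, where \<open>b k = k powr -s * ln k\<close>, against the
  decrement of \<open>b\<close> and against \<open>w\<close> respectively.
\<close>

lemma superlinear_recursion_bigo: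
  fixes a w :: "nat \<Rightarrow> real" and c q p s :: real
  assumes a_nonneg: "\<And>k. 0 \<le> a k" and c: "c > 0" and q: "q > 1"
    and rec: "\<forall>\<^sub>F k in sequentially. a (Suc k) powr q \<le> c * (a k - a (Suc k)) + w k"
    and w: "w \<in> O(\<lambda>k. real k powr (- p) * ln (real k) powr q)"
    and s: "0 < s" "s \<le> p - 1" "s \<le> 1 / (q - 1)"
  shows "a \<in> O(\<lambda>k. real k powr (- s) * ln (real k))"
proof -
  define b where "b k = real k powr (- s) * ln (real k)" for k
  have b_pos: "\<forall>\<^sub>F k in sequentially. 0 < b k"
    unfolding b_def by real_asymp
  have s_decr: "s * q \<le> s + 1" using s(3) q by (simp add: field_simps)
  with s(2) have s_w: "s * q \<le> p" by linarith
  have powr_bigo: "(\<lambda>k. real k powr x) \<in> O(\<lambda>k. real k powr y)" if "x \<le> y" for x y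
    using that by (intro bigoI[of _ 1] eventually_mono[OF eventually_ge_at_top[of 1]])
      (auto intro!: powr_mono)
  have b_powr: "(\<lambda>k. real k powr (- (s * q)) * ln (real k) powr q) \<in> O(\<lambda>k. b (Suc k) powr q)"
  proof -
    have "(\<lambda>k. b k powr q) \<in> O(\<lambda>k. b (Suc k) powr q)"
      unfolding b_def using s q by real_asymp
    moreover have "\<forall>\<^sub>F k in sequentially.
        b k powr q = real k powr (- (s * q)) * ln (real k) powr q"
      using eventually_ge_at_top[of 1]
      by eventually_elim (simp add: b_def powr_mult powr_powr)
    ultimately show ?thesis by (simp add: landau_o.big.in_cong)
  qed
  have "(\<lambda>k. c * (b k - b (Suc k))) \<in> O(\<lambda>k. real k powr (- (s + 1)) * ln (real k))"
    unfolding b_def using s c by real_asymp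
  also have "(\<lambda>k. real k powr (- (s + 1)) * ln (real k))
      \<in> O(\<lambda>k. real k powr (- (s * q)) * ln (real k) powr q)"
  proof (rule landau_o.big.mult)
    show "(\<lambda>k. real k powr (- (s + 1))) \<in> O(\<lambda>k. real k powr (- (s * q)))"
      using s_decr by (intro powr_bigo) simp
    show "(\<lambda>k. ln (real k)) \<in> O(\<lambda>k. ln (real k) powr q)"
      using q by real_asymp
  qed
  also note b_powr
  finally obtain D where D: "\<forall>\<^sub>F k in sequentially. c * (b k - b (Suc k)) \<le> D * b (Suc k) powr q"
    by (rule bigo_eventually_le_shifted) auto
  note w
  also have "(\<lambda>k. real k powr (- p) * ln (real k) powr q)
      \<in> O(\<lambda>k. real k powr (- (s * q)) * ln (real k) powr q)"
    using s_w by (intro landau_o.big.mult_right powr_bigo) simp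
  also note b_powr
  finally obtain C where C: "\<forall>\<^sub>F k in sequentially. w k \<le> C * b (Suc k) powr q"
    by (rule bigo_eventually_le_shifted) auto
  have "\<forall>\<^sub>F A in at_top. D * A + C \<le> A powr q"
    using q by real_asymp
  with a_nonneg c q rec b_pos C D have "a \<in> O(b)"
    by (intro bigo_by_barrier[where w = w and q = q and c = c and C = C and D = D]) auto
  thus ?thesis unfolding b_def .
qed

theorem lemma2p12:
  fixes \<alpha> w :: "nat \<Rightarrow> real" and p1 p2 c q :: real
  assumes "\<And>k. 0 \<le> \<alpha> k"
    and "\<alpha> \<longlonglongrightarrow> 0"
    and "\<And>k. 0 \<le> w k"
    and "p1 > 0" and "p2 > 0"
    and "w \<in> O(\<lambda>k. real k powr (- p2) * ln (real k) powr p1)"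
    and "c > 0" and "q \<in> {0<..<2}"
    and "\<And>k. \<alpha> (Suc k) powr q \<le> c * (\<alpha> k - \<alpha> (Suc k)) + w k"
  shows "(q \<in> {0<..<1} \<longrightarrow>
            \<alpha> \<in> o(\<lambda>k. real k powr (- p2) * ln (real k) powr p1)) \<and>
         (q = 1 \<longrightarrow>
            \<alpha> \<in> O(\<lambda>k. real k powr (- p2) * ln (real k) powr p1)) \<and>
         (q \<in> {1<..<2} \<and> p1 = q \<and> p2 > 1 \<longrightarrow>
            \<alpha> \<in> O(\<lambda>k. real k powr (- min p2 (q / (q - 1)) + 1) * ln (real k)))"
proof -
  let ?b = "\<lambda>k. real k powr (- p2) * ln (real k) powr p1"
  have b_pos: "\<forall>\<^sub>F k in sequentially. 0 < ?b k"
    by real_asymp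
  have b_ratio: "(\<lambda>k. ?b k / ?b (Suc k)) \<longlonglongrightarrow> 1"
    by real_asymp
  have "\<alpha> \<in> o(?b)" if "q \<in> {0<..<1}"
    using that by (intro sublinear_recursion_smallo[OF assms(1,2,7) _ _ assms(9) b_pos b_ratio assms(6)])
      auto
  moreover have "\<alpha> \<in> O(?b)" if "q = 1"
    using assms(9) that assms(1)
    by (intro linear_recursion_bigo[OF assms(1,7) _ b_pos b_ratio assms(6)]) simp
  moreover have "\<alpha> \<in> O(\<lambda>k. real k powr (- min p2 (q / (q - 1)) + 1) * ln (real k))"
    if "q \<in> {1<..<2} \<and> p1 = q \<and> p2 > 1"
  proof -
    define s where "s = min p2 (q / (q - 1)) - 1"
    have "q / (q - 1) - 1 = 1 / (q - 1)" using that by (simp add: field_simps)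
    hence "0 < s" "s \<le> p2 - 1" "s \<le> 1 / (q - 1)"
      using that by (auto simp: s_def min_def)
    hence "\<alpha> \<in> O(\<lambda>k. real k powr (- s) * ln (real k))"
      using that assms(6,9)
      by (intro superlinear_recursion_bigo[OF assms(1,7), where w = w and q = q and p = p2]) auto
    thus ?thesis by (simp add: s_def)
  qed
  ultimately show ?thesis by blast
qed

end
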